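(* Let $A$ and $B$ be isoclinic skew braces. Then there exists a skew brace $W$ with sub-skew braces $\bar A$ and $\bar B$ such that $A\cong\bar A$, $B\cong\bar B$, and $$\bar A\,\mathrm{Ann}(W)=\bar A\circ\mathrm{Ann}(W)=W=\bar B\circ\mathrm{Ann}(W)=\bar B\,\mathrm{Ann}(W).$$
   Context: A skew (left) brace is a set $A$ with two group structures $(A,\cdot)$, $(A,\circ)$ such that $a\circ(b\cdot c)=(a\circ b)\cdot a^{-1}\cdot(a\circ c)$ for all $a,b,c$, where $a^{-1}$ is the inverse in $(A,\cdot)$. The two identities coincide, denoted $1$. Put $\lambda_a(b)=a^{-1}\cdot(a\circ b)$, $a*b=\lambda_a(b)\cdot b^{-1}$, $[a,b]^{\cdot}=a\cdot b\cdot a^{-1}\cdot b^{-1}$. Brace homomorphisms preserve both operations; $\cong$ is brace isomorphism; a sub-skew brace is a subset that is a subgroup of both groups. An ideal is a subgroup of $(A,\cdot)$ stable under all $\lambda_a$ and normal in both groups. $\mathrm{Ann}(A)=\{a\in A: a*b=b*a=[a,b]^{\cdot}=1\ \forall b\in A\}$ (an ideal). $\Gamma_2(A)$ is the subgroup of $(A,\cdot)$ generated by all $a*b$ and $[a,b]^{\cdot}$, $a,b\in A$ (an ideal). $A$ and $B$ are isoclinic if there are brace isomorphisms $\xi:A/\mathrm{Ann}(A)\to B/\mathrm{Ann}(B)$ and $\theta:\Gamma_2(A)\to\Gamma_2(B)$ such that $\theta([a_1,a_2]^{\cdot})=[b_1,b_2]^{\cdot}$ and $\theta(a_1*a_2)=b_1*b_2$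 whenever $a_i\in A$, $b_i\in B$ satisfy $\xi(\mathrm{Ann}(A)a_i)=\mathrm{Ann}(B)b_i$, $i=1,2$. For subsets $S,T$ of $W$, $ST=\{s\cdot t: s\in S,t\in T\}$ and $S\circ T=\{s\circ t: s\in S,t\in T\}$. *)

theory Defs
  imports "HOL-Algebra.Coset" "HOL-Algebra.Generated_Groups"
begin

text \<open>A skew brace on a carrier set has the group (A, mult) inherited from the monoid record
  and a second group operation \<open>circ\<close>. The single field \<open>one\<close> serves both groups: the lemma
  \<open>skew_brace_identities_coincide\<close> below shows that this is no restriction.\<close>

record 'a skew_brace = "'a monoid" +
  circ :: "'a \<Rightarrow> 'a \<Rightarrow> 'a" (infixl "\<odot>\<index>" 70)

definition circ_group :: "('a, 'm) skew_brace_scheme \<Rightarrow> 'a monoid" where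
  "circ_group A = \<lparr>carrier = carrier A, mult = circ A, one = one A\<rparr>"

locale skew_brace = group A for A (structure) +
  assumes circ_group_is_group: "group (circ_group A)"
    and brace_distrib:
      "\<lbrakk>a \<in> carrier A; b \<in> carrier A; c \<in> carrier A\<rbrakk>
        \<Longrightarrow> a \<odot> (b \<otimes> c) = (a \<odot> b) \<otimes> inv a \<otimes> (a \<odot> c)"

lemma skew_brace_identities_coincide:
  fixes G H :: "'a monoid"
  assumes "group G" and "group H" and car: "carrier H = carrier G"
    and distrib: "\<And>a b c. \<lbrakk>a \<in> carrier G; b \<in> carrier G; c \<in> carrier G\<rbrakk> \<Longrightarrow>
      a \<otimes>\<^bsub>H\<^esub> (b \<otimes>\<^bsub>G\<^esub> c) = (a \<otimes>\<^bsub>H\<^esub> b) \<otimes>\<^bsub>G\<^esub> inv\<^bsub>G\<^esub> a \<otimes>\<^bsub>G\<^esub> (a \<otimes>\<^bsub>H\<^esub> c)"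
  shows "\<one>\<^bsub>H\<^esub> = \<one>\<^bsub>G\<^esub>"
proof -
  interpret G: group G by fact
  interpret H: group H by fact
  have e: "\<one>\<^bsub>H\<^esub> \<in> carrier G" using H.one_closed car by simp
  have l: "\<one>\<^bsub>H\<^esub> \<otimes>\<^bsub>H\<^esub> \<one>\<^bsub>G\<^esub> = \<one>\<^bsub>G\<^esub>" using H.l_one car by simp
  have "\<one>\<^bsub>G\<^esub> = \<one>\<^bsub>G\<^esub> \<otimes>\<^bsub>G\<^esub> inv\<^bsub>G\<^esub> \<one>\<^bsub>H\<^esub> \<otimes>\<^bsub>G\<^esub> \<one>\<^bsub>G\<^esub>"
    using distrib[OF e G.one_closed G.one_closed] l by simp
  then have "inv\<^bsub>G\<^esub> \<one>\<^bsub>H\<^esub> = \<one>\<^bsub>G\<^esub>" using e by simp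
  then show ?thesis using e by (metis G.inv_inv G.inv_one)
qed

definition brace_lambda :: "('a, 'm) skew_brace_scheme \<Rightarrow> 'a \<Rightarrow> 'a \<Rightarrow> 'a" where
  "brace_lambda A a b = inv\<^bsub>A\<^esub> a \<otimes>\<^bsub>A\<^esub> (a \<odot>\<^bsub>A\<^esub> b)"

definition brace_star :: "('a, 'm) skew_brace_scheme \<Rightarrow> 'a \<Rightarrow> 'a \<Rightarrow> 'a" where
  "brace_star A a b = brace_lambda A a b \<otimes>\<^bsub>A\<^esub> inv\<^bsub>A\<^esub> b"

definition brace_commutator :: "('a, 'm) skew_brace_scheme \<Rightarrow> 'a \<Rightarrow> 'a \<Rightarrow> 'a" where
  "brace_commutator A a b = a \<otimes>\<^bsub>A\<^esub> b \<otimes>\<^bsub>A\<^esub> inv\<^bsub>A\<^esub> a \<otimes>\<^bsub>A\<^esub> inv\<^bsub>A\<^esub> b"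

definition brace_hom ::
    "('a, 'm) skew_brace_scheme \<Rightarrow> ('b, 'n) skew_brace_scheme \<Rightarrow> ('a \<Rightarrow> 'b) set" where
  "brace_hom A B = hom A B \<inter> hom (circ_group A) (circ_group B)"

definition brace_iso ::
    "('a, 'm) skew_brace_scheme \<Rightarrow> ('b, 'n) skew_brace_scheme \<Rightarrow> ('a \<Rightarrow> 'b) set" where
  "brace_iso A B = {h \<in> brace_hom A B. bij_betw h (carrier A) (carrier B)}"

definition brace_isomorphic ::
    "('a, 'm) skew_brace_scheme \<Rightarrow> ('b, 'n) skew_brace_scheme \<Rightarrow> bool" where
  "brace_isomorphic A B \<longleftrightarrow> brace_iso A B \<noteq> {}"

definition sub_skew_brace :: "'a set \<Rightarrow> ('a, 'm) skew_brace_scheme \<Rightarrow> bool" where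
  "sub_skew_brace S A \<longleftrightarrow> subgroup S A \<and> subgroup S (circ_group A)"

definition Ann :: "('a, 'm) skew_brace_scheme \<Rightarrow> 'a set" where
  "Ann A = {a \<in> carrier A. \<forall>b \<in> carrier A.
     brace_star A a b = \<one>\<^bsub>A\<^esub> \<and> brace_star A b a = \<one>\<^bsub>A\<^esub> \<and> brace_commutator A a b = \<one>\<^bsub>A\<^esub>}"

definition Gamma2 :: "('a, 'm) skew_brace_scheme \<Rightarrow> 'a set" where
  "Gamma2 A = generate A
     ({brace_star A a b | a b. a \<in> carrier A \<and> b \<in> carrier A} \<union>
      {brace_commutator A a b | a b. a \<in> carrier A \<and> b \<in> carrier A})"

text \<open>For an ideal I the cosets of I in the two groups are the same sets, and the product (in
  either group) of two cosets, formed elementwise, is again a coset. Hence both operations of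
  A/I are given by products of sets, as in \<open>FactGroup\<close>.\<close>

definition brace_quotient :: "('a, 'm) skew_brace_scheme \<Rightarrow> 'a set \<Rightarrow> 'a set skew_brace" where
  "brace_quotient A I =
     \<lparr>carrier = rcosets\<^bsub>A\<^esub> I, mult = set_mult A, one = I, circ = set_mult (circ_group A)\<rparr>"

definition isoclinic ::
    "('a, 'm) skew_brace_scheme \<Rightarrow> ('b, 'n) skew_brace_scheme \<Rightarrow> bool" where
  "isoclinic A B \<longleftrightarrow>
     (\<exists>\<xi> \<in> brace_iso (brace_quotient A (Ann A)) (brace_quotient B (Ann B)).
      \<exists>\<theta> \<in> brace_iso (A\<lparr>carrier := Gamma2 A\<rparr>) (B\<lparr>carrier := Gamma2 B\<rparr>).
      \<forall>a\<^sub>1 \<in> carrier A. \<forall>a\<^sub>2 \<in> carrier A. \<forall>b\<^sub>1 \<in> carrier B. \<forall>b\<^sub>2 \<in> carrier B.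
        \<xi> (Ann A #>\<^bsub>A\<^esub> a\<^sub>1) = Ann B #>\<^bsub>B\<^esub> b\<^sub>1 \<and> \<xi> (Ann A #>\<^bsub>A\<^esub> a\<^sub>2) = Ann B #>\<^bsub>B\<^esub> b\<^sub>2 \<longrightarrow>
          \<theta> (brace_commutator A a\<^sub>1 a\<^sub>2) = brace_commutator B b\<^sub>1 b\<^sub>2 \<and>
          \<theta> (brace_star A a\<^sub>1 a\<^sub>2) = brace_star B b\<^sub>1 b\<^sub>2)"

end

theory Submission
  imports Defs
begin

text \<open>
  Let \<open>\<xi>\<close> and \<open>\<theta>\<close> witness the isoclinism. The pairs \<open>(a, b)\<close> with \<open>\<xi> (Ann A a) = Ann B b\<close> form a
  sub-skew brace \<open>C\<close> of \<open>A \<times> B\<close> that projects onto both factors, so \<open>A\<close> and \<open>B\<close> are quotients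
  of \<open>C\<close>. What isoclinism adds is that \<open>\<Gamma>\<^sub>2(C)\<close> lies in the graph of \<open>\<theta>\<close>
  (\<open>Gamma2_pullback_graph\<close>): compatibility says precisely that the generators of \<open>\<Gamma>\<^sub>2(C)\<close> do.
  As \<open>\<theta>\<close> is injective, an element of \<open>\<Gamma>\<^sub>2(C)\<close> with one trivial coordinate is trivial.

  The quotient \<open>T = C/\<Gamma>\<^sub>2(C)\<close> is a trivial skew brace on an abelian group, that is \<open>Ann T = T\<close>.
  By the graph property \<open>j(a, b) = (a, [(a, b)])\<close> embeds \<open>C\<close> into \<open>A \<times> T\<close>. The kernel of the
  projection \<open>C \<rightarrow> B\<close> consists of the pairs \<open>(z, 1)\<close> with \<open>z \<in> Ann A\<close>, so its image \<open>N\<close> under \<open>j\<close>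
  lies in \<open>Ann A \<times> T\<close> and hence in \<open>Ann (A \<times> T)\<close>. Every subgroup of the annihilator is an ideal
  (\<open>central_subgroup_ideal\<close>), so \<open>W = (A \<times> T)/N\<close> is a skew brace.

  Both braces embed into \<open>W\<close>. The map \<open>C \<rightarrow> W\<close> induced by \<open>j\<close> has the same kernel as \<open>C \<rightarrow> B\<close>, so its
  image is a copy of \<open>B\<close>. The map \<open>a \<mapsto> N (a, 1)\<close> is injective: if \<open>(a, 1)\<close> equals \<open>j(z, 1)\<close> then \<open>a = z\<close>
  and \<open>(z, 1) \<in> \<Gamma>\<^sub>2(C)\<close>, which forces \<open>z = 1\<close>. Both images contain, for each \<open>a \<in> A\<close>, the class
  of some pair with first coordinate \<open>a\<close>; multiplying by the classes of \<open>1 \<times> T\<close>, which annihilate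
  \<open>W\<close>, one reaches every element of \<open>W\<close> (\<open>covers_overbrace\<close>).
\<close>

section \<open>Skew braces and their homomorphisms\<close>

lemma circ_group_simps [simp]:
  "carrier (circ_group A) = carrier A" "mult (circ_group A) = circ A" "one (circ_group A) = one A"
  by (simp_all add: circ_group_def)

lemma circ_group_carrier_update [simp]:
  "circ_group (A\<lparr>carrier := S\<rparr>) = (circ_group A)\<lparr>carrier := S\<rparr>"
  by (simp add: circ_group_def)

context skew_brace
begin

sublocale circ: group "circ_group A"
  by (rule circ_group_is_group)

lemma circ_closed [simp]: "\<lbrakk>a \<in> carrier A; b \<in> carrier A\<rbrakk> \<Longrightarrow> a \<odot> b \<in> carrier A"
  using circ.m_closed by simp

lemma circ_one [simp]: "a \<in> carrier A \<Longrightarrow> a \<odot> \<one> = a" "a \<in> carrier A \<Longrightarrow> \<one> \<odot> a = a"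
  using circ.r_one circ.l_one by simp_all

lemma circ_assoc:
  "\<lbrakk>a \<in> carrier A; b \<in> carrier A; c \<in> carrier A\<rbrakk> \<Longrightarrow> a \<odot> b \<odot> c = a \<odot> (b \<odot> c)"
  using circ.m_assoc by simp

lemma star_closed [simp]:
  "\<lbrakk>a \<in> carrier A; b \<in> carrier A\<rbrakk> \<Longrightarrow> brace_star A a b \<in> carrier A"
  by (simp add: brace_star_def brace_lambda_def)

lemma commutator_closed [simp]:
  "\<lbrakk>a \<in> carrier A; b \<in> carrier A\<rbrakk> \<Longrightarrow> brace_commutator A a b \<in> carrier A"
  by (simp add: brace_commutator_def)

lemma inv_mult_cancel [simp]:
  assumes "a \<in> carrier A" "b \<in> carrier A"
  shows "inv a \<otimes> (a \<otimes> b) = b" "a \<otimes> (inv a \<otimes> b) = b"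
  using assms by (simp_all flip: m_assoc)

lemma circ_eq_mult_star:
  "\<lbrakk>a \<in> carrier A; b \<in> carrier A\<rbrakk> \<Longrightarrow> a \<odot> b = a \<otimes> brace_star A a b \<otimes> b"
  by (simp add: brace_star_def brace_lambda_def m_assoc)

lemma mult_eq_commutator_mult:
  "\<lbrakk>a \<in> carrier A; b \<in> carrier A\<rbrakk> \<Longrightarrow> a \<otimes> b = brace_commutator A a b \<otimes> (b \<otimes> a)"
  by (simp add: brace_commutator_def m_assoc)

lemma star_eq_one_iff:
  assumes "a \<in> carrier A" "b \<in> carrier A"
  shows "brace_star A a b = \<one> \<longleftrightarrow> a \<odot> b = a \<otimes> b"
proof
  assume "brace_star A a b = \<one>"
  then show "a \<odot> b = a \<otimes> b" using circ_eq_mult_star[OF assms] assms by simp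
next
  assume "a \<odot> b = a \<otimes> b"
  then show "brace_star A a b = \<one>"
    using assms by (simp add: brace_star_def brace_lambda_def flip: m_assoc)
qed

lemma commutator_eq_one_iff:
  assumes "a \<in> carrier A" "b \<in> carrier A"
  shows "brace_commutator A a b = \<one> \<longleftrightarrow> a \<otimes> b = b \<otimes> a"
proof
  assume "brace_commutator A a b = \<one>"
  then show "a \<otimes> b = b \<otimes> a" using mult_eq_commutator_mult[OF assms] assms by simp
next
  assume "a \<otimes> b = b \<otimes> a"
  then show "brace_commutator A a b = \<one>"
    using assms by (simp add: brace_commutator_def m_assoc[of _ "inv a"]) (simp add: m_assoc)
qed

text \<open>The annihilator consists of the elements for which all four products with any other element
  collapse to one; in this form its closure properties become equational.\<close>

lemma Ann_iff:
  "a \<in> Ann A \<longleftrightarrow> a \<in> carrier A \<and>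
     (\<forall>b \<in> carrier A. a \<odot> b = a \<otimes> b \<and> b \<odot> a = b \<otimes> a \<and> a \<otimes> b = b \<otimes> a)"
  by (auto simp: Ann_def star_eq_one_iff commutator_eq_one_iff)

lemma AnnD:
  assumes "z \<in> Ann A"
  shows Ann_closed: "z \<in> carrier A"
    and Ann_circ: "b \<in> carrier A \<Longrightarrow> z \<odot> b = z \<otimes> b"
    and circ_Ann: "b \<in> carrier A \<Longrightarrow> b \<odot> z = b \<otimes> z"
    and Ann_commute: "b \<in> carrier A \<Longrightarrow> z \<otimes> b = b \<otimes> z"
  using assms unfolding Ann_iff by blast+

text \<open>Reduces the two factorisations of the overbrace by the circle operation to the ones by
  the group multiplication: the operations agree as soon as one argument is in the annihilator.\<close>

lemma set_mult_Ann:
  assumes "S \<subseteq> carrier A"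
  shows "S <#>\<^bsub>circ_group A\<^esub> Ann A = S <#> Ann A"
proof -
  have "s \<odot> z = s \<otimes> z" if "s \<in> S" "z \<in> Ann A" for s z
    using that assms circ_Ann by blast
  then show ?thesis by (simp add: set_mult_def cong: SUP_cong)
qed

lemma sub_skew_brace_imp_skew_brace:
  assumes "sub_skew_brace S A"
  shows "skew_brace (A\<lparr>carrier := S\<rparr>)"
proof -
  have S: "subgroup S A" "subgroup S (circ_group A)"
    using assms by (simp_all add: sub_skew_brace_def)
  show ?thesis
  proof (intro skew_brace.intro skew_brace_axioms.intro)
    show "group (A\<lparr>carrier := S\<rparr>)" by (rule subgroup.subgroup_is_group[OF S(1) is_group])
    show "group (circ_group (A\<lparr>carrier := S\<rparr>))"
      using subgroup.subgroup_is_group[OF S(2) circ_group_is_group] by simp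
  qed (use subgroup.subset[OF S(1)] in \<open>auto simp: m_inv_consistent[OF S(1)] brace_distrib subset_iff\<close>)
qed

end

lemma brace_homD:
  assumes "f \<in> brace_hom A B" "x \<in> carrier A"
  shows "f x \<in> carrier B"
    and "y \<in> carrier A \<Longrightarrow> f (x \<otimes>\<^bsub>A\<^esub> y) = f x \<otimes>\<^bsub>B\<^esub> f y"
    and "y \<in> carrier A \<Longrightarrow> f (x \<odot>\<^bsub>A\<^esub> y) = f x \<odot>\<^bsub>B\<^esub> f y"
  using assms by (auto simp: brace_hom_def hom_def)

lemma brace_homI:
  assumes "\<And>x. x \<in> carrier A \<Longrightarrow> f x \<in> carrier B"
    and "\<And>x y. \<lbrakk>x \<in> carrier A; y \<in> carrier A\<rbrakk> \<Longrightarrow> f (x \<otimes>\<^bsub>A\<^esub> y) = f x \<otimes>\<^bsub>B\<^esub> f y"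
    and "\<And>x y. \<lbrakk>x \<in> carrier A; y \<in> carrier A\<rbrakk> \<Longrightarrow> f (x \<odot>\<^bsub>A\<^esub> y) = f x \<odot>\<^bsub>B\<^esub> f y"
  shows "f \<in> brace_hom A B"
  using assms by (auto simp: brace_hom_def hom_def)

lemma brace_hom_compose:
  assumes "f \<in> brace_hom A B" "g \<in> brace_hom B C"
  shows "(\<lambda>x. g (f x)) \<in> brace_hom A C"
  by (rule brace_homI) (simp_all add: brace_homD[OF assms(1)] brace_homD[OF assms(2)])

lemma brace_hom_restrict:
  assumes "f \<in> brace_hom A B" "S \<subseteq> carrier A"
  shows "f \<in> brace_hom (A\<lparr>carrier := S\<rparr>) B"
  using assms by (intro brace_homI) (auto simp: brace_homD subset_iff)

locale skew_brace_hom = A: skew_brace A + B: skew_brace B for A (structure) and B (structure) +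
  fixes f
  assumes hom: "f \<in> brace_hom A B"
begin

lemmas closed [simp] = brace_homD(1)[OF hom]
lemmas mult [simp] = brace_homD(2)[OF hom]
lemmas circ [simp] = brace_homD(3)[OF hom]

sublocale group_hom A B f
  using hom by unfold_locales (simp add: brace_hom_def)

sublocale circ: group_hom "circ_group A" "circ_group B" f
  using hom by unfold_locales (simp add: brace_hom_def)

lemma star:
  "\<lbrakk>a \<in> carrier A; b \<in> carrier A\<rbrakk> \<Longrightarrow> f (brace_star A a b) = brace_star B (f a) (f b)"
  by (simp add: brace_star_def brace_lambda_def)

lemma commutator:
  "\<lbrakk>a \<in> carrier A; b \<in> carrier A\<rbrakk> \<Longrightarrow> f (brace_commutator A a b) = brace_commutator B (f a) (f b)"
  by (simp add: brace_commutator_def)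

lemma surj_maps_Ann:
  assumes "f ` carrier A = carrier B" "z \<in> Ann A"
  shows "f z \<in> Ann B"
proof -
  have z: "z \<in> carrier A" using assms(2) by (rule A.Ann_closed)
  have "f z \<odot>\<^bsub>B\<^esub> b = f z \<otimes>\<^bsub>B\<^esub> b \<and> b \<odot>\<^bsub>B\<^esub> f z = b \<otimes>\<^bsub>B\<^esub> f z \<and> f z \<otimes>\<^bsub>B\<^esub> b = b \<otimes>\<^bsub>B\<^esub> f z"
    if "b \<in> carrier B" for b
  proof -
    have "b \<in> f ` carrier A" using that assms(1) by simp
    then obtain a where a: "a \<in> carrier A" "b = f a" by (rule imageE)
    show ?thesis
      using A.AnnD(2-4)[OF assms(2) a(1)] mult[OF z a(1)] mult[OF a(1) z] circ[OF z a(1)]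
        circ[OF a(1) z] a(2) by simp
  qed
  then show ?thesis using z by (simp add: B.Ann_iff)
qed

lemma image_sub_skew_brace: "sub_skew_brace (f ` carrier A) B"
  using img_is_subgroup circ.img_is_subgroup by (simp add: sub_skew_brace_def)

end

lemma skew_brace_homI:
  "\<lbrakk>skew_brace A; skew_brace B; f \<in> brace_hom A B\<rbrakk> \<Longrightarrow> skew_brace_hom A B f"
  by (simp add: skew_brace_hom_def skew_brace_hom_axioms_def)

text \<open>Both \<open>B\<close> and the image of \<open>g\<close> are the quotient of \<open>C\<close> by the common kernel, so the isomorphism
  sends \<open>p x\<close> to \<open>g x\<close>. It lets \<open>B\<close>, which is only a quotient of the pullback, be embedded without
  choosing representatives compatibly with the operations.\<close>

lemma kernel_eq_imp_isomorphic_image: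
  assumes "skew_brace_hom C B p" "skew_brace_hom C W g"
    and surj: "p ` carrier C = carrier B" and ker: "kernel C B p = kernel C W g"
  shows "brace_isomorphic B (W\<lparr>carrier := g ` carrier C\<rparr>)"
proof -
  interpret p: skew_brace_hom C B p by fact
  interpret g: skew_brace_hom C W g by fact
  have eq: "p x = p y \<longleftrightarrow> g x = g y" if xy: "x \<in> carrier C" "y \<in> carrier C" for x y
  proof -
    have "p x = p y \<longleftrightarrow> x \<otimes>\<^bsub>C\<^esub> inv\<^bsub>C\<^esub> y \<in> kernel C B p"
      using xy p.B.inv_solve_right'[of "\<one>\<^bsub>B\<^esub>" "p x" "p y"] by (auto simp: kernel_def)
    also have "\<dots> \<longleftrightarrow> g x = g y"
      using xy g.B.inv_solve_right'[of "\<one>\<^bsub>W\<^esub>" "g x" "g y"] unfolding ker by (auto simp: kernel_def)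
    finally show ?thesis .
  qed
  \<comment> \<open>A set-theoretic section of \<open>p\<close>; by \<open>eq\<close> the value \<open>g (s b)\<close> is independent of its choice.\<close>
  define s where "s = inv_into (carrier C) p"
  have s: "s b \<in> carrier C" "p (s b) = b" if "b \<in> carrier B" for b
    using that surj by (auto simp: s_def inv_into_into f_inv_into_f)
  have gs: "g (s (p x)) = g x" if "x \<in> carrier C" for x
    using that s[of "p x"] by (simp flip: eq)
  have "(\<lambda>b. g (s b)) \<in> brace_hom B (W\<lparr>carrier := g ` carrier C\<rparr>)"
  proof (rule brace_homI)
    fix a b assume ab: "a \<in> carrier B" "b \<in> carrier B"
    have "a \<otimes>\<^bsub>B\<^esub> b = p (s a \<otimes>\<^bsub>C\<^esub> s b)" "a \<odot>\<^bsub>B\<^esub> b = p (s a \<odot>\<^bsub>C\<^esub> s b)"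
      using ab s by simp_all
    then show "g (s (a \<otimes>\<^bsub>B\<^esub> b)) = g (s a) \<otimes>\<^bsub>W\<lparr>carrier := g ` carrier C\<rparr>\<^esub> g (s b)"
      "g (s (a \<odot>\<^bsub>B\<^esub> b)) = g (s a) \<odot>\<^bsub>W\<lparr>carrier := g ` carrier C\<rparr>\<^esub> g (s b)"
      using ab s by (simp_all add: gs del: p.mult p.circ)
  qed (simp add: s)
  moreover have "bij_betw (\<lambda>b. g (s b)) (carrier B) (g ` carrier C)"
  proof (rule bij_betw_imageI)
    show "inj_on (\<lambda>b. g (s b)) (carrier B)" by (rule inj_onI) (metis eq s)
    have "(\<lambda>b. g (s b)) ` carrier B = (\<lambda>x. g (s (p x))) ` carrier C"
      by (simp add: image_image flip: surj)
    then show "(\<lambda>b. g (s b)) ` carrier B = g ` carrier C" by (simp add: gs cong: image_cong)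
  qed
  ultimately show ?thesis by (auto simp: brace_isomorphic_def brace_iso_def)
qed

text \<open>The axioms pass along any map that preserves both operations, so a quotient is a skew brace once
  the coset map is known to be such a map.\<close>

lemma skew_brace_surj_image:
  assumes "skew_brace A" and f: "f \<in> brace_hom A X"
    and surj: "f ` carrier A = carrier X" and one: "f \<one>\<^bsub>A\<^esub> = \<one>\<^bsub>X\<^esub>"
  shows "skew_brace X"
proof -
  interpret A: skew_brace A by fact
  have "f \<in> hom A X" "f \<in> hom (circ_group A) (circ_group X)"
    using f by (simp_all add: brace_hom_def)
  note this[THEN group.hom_imp_img_group[rotated]]
  then have X: "group X" and cX: "group (circ_group X)"
    using A.is_group A.circ_group_is_group surj one by (simp_all add: circ_group_def)
  interpret X: group X by fact
  interpret f: group_hom A X f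
    using f by unfold_locales (simp add: brace_hom_def)
  show ?thesis
  proof (intro skew_brace.intro skew_brace_axioms.intro X cX)
    fix x y z assume "x \<in> carrier X" "y \<in> carrier X" "z \<in> carrier X"
    then obtain a b c where abc: "a \<in> carrier A" "b \<in> carrier A" "c \<in> carrier A"
      and eq: "x = f a" "y = f b" "z = f c"
      unfolding surj[symmetric] by blast
    have "f (a \<odot>\<^bsub>A\<^esub> (b \<otimes>\<^bsub>A\<^esub> c)) = f (a \<odot>\<^bsub>A\<^esub> b \<otimes>\<^bsub>A\<^esub> inv\<^bsub>A\<^esub> a \<otimes>\<^bsub>A\<^esub> (a \<odot>\<^bsub>A\<^esub> c))"
      using abc by (simp add: A.brace_distrib)
    then show "x \<odot>\<^bsub>X\<^esub> (y \<otimes>\<^bsub>X\<^esub> z) = x \<odot>\<^bsub>X\<^esub> y \<otimes>\<^bsub>X\<^esub> inv\<^bsub>X\<^esub> x \<otimes>\<^bsub>X\<^esub> (x \<odot>\<^bsub>X\<^esub> z)"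
      using abc eq by (simp add: brace_homD(3)[OF f])
  qed
qed

lemma subgroup_equalizer:
  assumes "group_hom G H f" "group_hom G H g"
  shows "subgroup {x \<in> carrier G. f x = g x} G"
proof -
  interpret f: group_hom G H f by fact
  interpret g: group_hom G H g by fact
  show ?thesis by (rule f.G.subgroupI) auto
qed

lemma sub_skew_brace_equalizer:
  assumes "skew_brace_hom A B f" "skew_brace_hom A B g"
  shows "sub_skew_brace {x \<in> carrier A. f x = g x} A"
proof -
  interpret f: skew_brace_hom A B f by fact
  interpret g: skew_brace_hom A B g by fact
  show ?thesis
    using subgroup_equalizer[OF f.group_hom_axioms g.group_hom_axioms]
      subgroup_equalizer[OF f.circ.group_hom_axioms g.circ.group_hom_axioms]
    by (simp add: sub_skew_brace_def)
qed

section \<open>Direct products\<close>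

definition brace_prod ::
    "('a, 'm) skew_brace_scheme \<Rightarrow> ('b, 'n) skew_brace_scheme \<Rightarrow> ('a \<times> 'b) skew_brace" where
  "brace_prod A B = \<lparr>carrier = carrier A \<times> carrier B,
     mult = (\<lambda>(a, b) (a', b'). (a \<otimes>\<^bsub>A\<^esub> a', b \<otimes>\<^bsub>B\<^esub> b')), one = (\<one>\<^bsub>A\<^esub>, \<one>\<^bsub>B\<^esub>),
     circ = (\<lambda>(a, b) (a', b'). (a \<odot>\<^bsub>A\<^esub> a', b \<odot>\<^bsub>B\<^esub> b'))\<rparr>"

lemma brace_prod_simps [simp]:
  "carrier (brace_prod A B) = carrier A \<times> carrier B"
  "(a, b) \<otimes>\<^bsub>brace_prod A B\<^esub> (a', b') = (a \<otimes>\<^bsub>A\<^esub> a', b \<otimes>\<^bsub>B\<^esub> b')"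
  "(a, b) \<odot>\<^bsub>brace_prod A B\<^esub> (a', b') = (a \<odot>\<^bsub>A\<^esub> a', b \<odot>\<^bsub>B\<^esub> b')"
  "\<one>\<^bsub>brace_prod A B\<^esub> = (\<one>\<^bsub>A\<^esub>, \<one>\<^bsub>B\<^esub>)"
  by (simp_all add: brace_prod_def)

lemma skew_brace_prod:
  assumes "skew_brace A" "skew_brace B"
  shows "skew_brace (brace_prod A B)"
proof -
  interpret A: skew_brace A by fact
  interpret B: skew_brace B by fact
  interpret P: group "brace_prod A B"
  proof (rule groupI)
    fix x assume "x \<in> carrier (brace_prod A B)"
    then show "\<exists>y \<in> carrier (brace_prod A B). y \<otimes>\<^bsub>brace_prod A B\<^esub> x = \<one>\<^bsub>brace_prod A B\<^esub>"
      by (intro bexI[of _ "(inv\<^bsub>A\<^esub> fst x, inv\<^bsub>B\<^esub> snd x)"]) auto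
  qed (auto simp: A.m_assoc B.m_assoc)
  have inv: "inv\<^bsub>brace_prod A B\<^esub> (a, b) = (inv\<^bsub>A\<^esub> a, inv\<^bsub>B\<^esub> b)"
    if "a \<in> carrier A" "b \<in> carrier B" for a b
    using that by (intro P.inv_equality) auto
  have "circ_group (brace_prod A B) = circ_group A \<times>\<times> circ_group B"
    by (simp add: circ_group_def brace_prod_def DirProd_def)
  then have "group (circ_group (brace_prod A B))"
    using DirProd_group[OF A.circ_group_is_group B.circ_group_is_group] by simp
  then show ?thesis
    by (intro skew_brace.intro skew_brace_axioms.intro P.is_group)
      (auto simp: inv A.brace_distrib B.brace_distrib)
qed

lemma Ann_prod:
  assumes "skew_brace A" "skew_brace B" "a \<in> Ann A" "b \<in> Ann B"
  shows "(a, b) \<in> Ann (brace_prod A B)"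
proof -
  interpret A: skew_brace A by fact
  interpret B: skew_brace B by fact
  interpret P: skew_brace "brace_prod A B" by (rule skew_brace_prod) fact+
  show ?thesis
    using A.AnnD[OF assms(3)] B.AnnD[OF assms(4)] unfolding P.Ann_iff by force
qed

lemma fst_brace_hom: "fst \<in> brace_hom (brace_prod A B) A"
  and snd_brace_hom: "snd \<in> brace_hom (brace_prod A B) B"
  by (auto intro!: brace_homI)

section \<open>Ideals and quotients\<close>

definition brace_ideal :: "'a set \<Rightarrow> ('a, 'm) skew_brace_scheme \<Rightarrow> bool" where
  "brace_ideal I A \<longleftrightarrow> I \<lhd> A \<and> I \<lhd> circ_group A \<and>
     (\<forall>a \<in> carrier A. \<forall>x \<in> I. brace_lambda A a x \<in> I)"

context skew_brace
begin

text \<open>As \<open>a \<odot> x = a \<otimes> \<lambda>\<^sub>a(x)\<close>, the two cosets agree when \<open>\<lambda>\<^sub>a\<close> maps \<open>I\<close> onto itself. An ideal is only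
  required to be mapped into itself, and surjectivity comes from the stability under \<open>\<lambda>\<close> of the circle
  inverse of \<open>a\<close>, which inverts \<open>\<lambda>\<^sub>a\<close>.\<close>

lemma ideal_l_coset_circ:
  assumes "brace_ideal I A" "a \<in> carrier A"
  shows "a <#\<^bsub>circ_group A\<^esub> I = a <# I"
proof -
  interpret I: normal I A using assms(1) by (simp add: brace_ideal_def)
  have lam: "brace_lambda A b x \<in> I" if "b \<in> carrier A" "x \<in> I" for b x
    using assms(1) that by (simp add: brace_ideal_def)
  define a' where "a' = inv\<^bsub>circ_group A\<^esub> a"
  have a': "a' \<in> carrier A" "a \<odot> a' = \<one>"
    using assms(2) circ.r_inv circ.inv_closed by (simp_all add: a'_def)
  have "a \<odot> x \<in> a <# I" if "x \<in> I" for x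
  proof -
    have "a \<odot> x = a \<otimes> brace_lambda A a x"
      using that assms(2) by (simp add: brace_lambda_def flip: m_assoc)
    then show ?thesis using lam[OF assms(2) that] by (auto simp: l_coset_def)
  qed
  moreover have "a \<otimes> x \<in> a <#\<^bsub>circ_group A\<^esub> I" if "x \<in> I" for x
  proof -
    have x: "x \<in> carrier A" using that by simp
    \<comment> \<open>With \<open>a'\<close> the circle inverse of \<open>a\<close>, the element \<open>\<lambda>\<^bsub>a'\<^esub>(x) \<in> I\<close> is the \<open>\<lambda>\<^sub>a\<close>-preimage of \<open>x\<close>.\<close>
    have "a \<odot> (inv a' \<otimes> (a' \<odot> x)) = (a \<odot> inv a') \<otimes> inv a \<otimes> (a \<odot> (a' \<odot> x))"
      using assms(2) a' x by (simp add: brace_distrib)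
    also have "a \<odot> (a' \<odot> x) = x" using assms(2) a' x by (simp flip: circ_assoc)
    also have "(a \<odot> inv a') \<otimes> inv a = a"
    proof -
      have "\<one> = a \<odot> (inv a' \<otimes> a') \<otimes> inv a" using assms(2) a' by simp
      also have "\<dots> = (a \<odot> inv a') \<otimes> inv a \<otimes> inv a"
        using assms(2) a' by (subst brace_distrib) simp_all
      finally show ?thesis using assms(2) a'
        by (metis circ_closed inv_closed inv_equality inv_inv m_closed)
    qed
    finally have "a \<odot> brace_lambda A a' x = a \<otimes> x" by (simp add: brace_lambda_def)
    then show ?thesis using lam[OF a'(1) that] by (auto simp: l_coset_def intro: bexI[of _ "brace_lambda A a' x"])
  qed
  ultimately show ?thesis by (auto simp: l_coset_def)
qed

lemma ideal_r_coset_circ: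
  assumes "brace_ideal I A" "a \<in> carrier A"
  shows "I #>\<^bsub>circ_group A\<^esub> a = I #> a"
proof -
  have "I \<lhd> A" "I \<lhd> circ_group A" using assms(1) by (simp_all add: brace_ideal_def)
  then show ?thesis
    using normal.coset_eq[of I A] normal.coset_eq[of I "circ_group A"] assms
    by (simp add: ideal_l_coset_circ)
qed

text \<open>The circle operation of the quotient multiplies cosets elementwise. This is well behaved for
  the cosets of the circle group, which by \<open>ideal_r_coset_circ\<close> are the same sets.\<close>

lemma quotient_map_hom:
  assumes "brace_ideal I A"
  shows "(\<lambda>a. I #> a) \<in> brace_hom A (brace_quotient A I)"
proof (rule brace_homI)
  have I: "I \<lhd> A" "I \<lhd> circ_group A" using assms by (simp_all add: brace_ideal_def)
  fix a b assume ab: "a \<in> carrier A" "b \<in> carrier A"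
  show "I #> (a \<otimes> b) = (I #> a) \<otimes>\<^bsub>brace_quotient A I\<^esub> (I #> b)"
    using normal.rcos_sum[OF I(1) ab] by (simp add: brace_quotient_def)
  show "I #> (a \<odot> b) = (I #> a) \<odot>\<^bsub>brace_quotient A I\<^esub> (I #> b)"
    using normal.rcos_sum[OF I(2)] ab
    by (simp add: brace_quotient_def flip: ideal_r_coset_circ[OF assms])
qed (auto simp: brace_quotient_def RCOSETS_def)

lemma quotient_map_surj: "(\<lambda>a. I #> a) ` carrier A = carrier (brace_quotient A I)"
  by (auto simp: brace_quotient_def RCOSETS_def)

lemma quotient_skew_brace:
  assumes "brace_ideal I A"
  shows "skew_brace (brace_quotient A I)"
proof (rule skew_brace_surj_image[OF skew_brace_axioms quotient_map_hom[OF assms] quotient_map_surj])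
  have "I \<subseteq> carrier A"
    using assms by (auto simp: brace_ideal_def dest: normal_imp_subgroup subgroup.mem_carrier)
  then show "I #> \<one> = \<one>\<^bsub>brace_quotient A I\<^esub>" by (simp add: brace_quotient_def)
qed

lemma quotient_map_skew_brace_hom:
  assumes "brace_ideal I A"
  shows "skew_brace_hom A (brace_quotient A I) (\<lambda>a. I #> a)"
  by (intro skew_brace_homI skew_brace_axioms quotient_skew_brace quotient_map_hom assms)

lemma quotient_map_kernel:
  assumes "brace_ideal I A"
  shows "kernel A (brace_quotient A I) (\<lambda>a. I #> a) = I"
proof -
  interpret I: normal I A using assms by (simp add: brace_ideal_def)
  show ?thesis
    using rcos_self[OF _ I.is_subgroup] I.rcos_const
    by (auto simp: kernel_def brace_quotient_def I.is_subgroup)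
qed

text \<open>On the annihilator the two operations agree and are central, so \<open>\<lambda>\<close> fixes it pointwise and
  normality is automatic. It covers both \<open>Ann A\<close> itself and the subgroup factored out in the
  construction of the overbrace.\<close>

lemma central_subgroup_ideal:
  assumes "subgroup I A" "I \<subseteq> Ann A"
  shows "brace_ideal I A"
proof -
  interpret I: subgroup I A by fact
  have ann: "x \<odot> b = x \<otimes> b" "b \<odot> x = b \<otimes> x" "x \<otimes> b = b \<otimes> x"
    if "x \<in> I" "b \<in> carrier A" for x b
    using AnnD(2-4)[of x b] that assms(2) by blast+
  have sub: "subgroup I (circ_group A)"
  proof (rule circ.subgroupI)
    show "I \<noteq> {}" using I.one_closed by blast
    fix x y assume xy: "x \<in> I" "y \<in> I"
    then have "inv\<^bsub>circ_group A\<^esub> x = inv x"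
      by (intro circ.inv_equality) (simp_all add: ann(2))
    then show "inv\<^bsub>circ_group A\<^esub> x \<in> I" using xy by simp
    show "x \<otimes>\<^bsub>circ_group A\<^esub> y \<in> I" using xy by (simp add: ann(1))
  qed auto
  have "I \<lhd> A"
    using assms(1) by (rule normalI) (auto simp: r_coset_def l_coset_def ann(3))
  moreover have "I \<lhd> circ_group A"
    using sub by (rule circ.normalI) (auto simp: r_coset_def l_coset_def ann)
  moreover have "brace_lambda A a x \<in> I" if "a \<in> carrier A" "x \<in> I" for a x
    using that by (simp add: brace_lambda_def ann(2))
  ultimately show ?thesis by (simp add: brace_ideal_def)
qed

text \<open>The point is inverses: for \<open>x \<in> Ann A\<close> the inverse is the circle inverse as well, so cancelling \<open>x\<close>
  in either group from the identities for \<open>x\<close> gives those for its inverse.\<close>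

lemma Ann_subgroup: "subgroup (Ann A) A"
proof (rule subgroupI)
  have "\<one> \<in> Ann A" by (simp add: Ann_iff)
  then show "Ann A \<noteq> {}" by blast
next
  fix x assume x: "x \<in> Ann A"
  have c: "x \<in> carrier A" "inv x \<in> carrier A" using Ann_closed[OF x] by simp_all
  have l: "inv x \<odot> x = \<one>" and r: "x \<odot> inv x = \<one>"
    using c by (simp_all add: Ann_circ[OF x] circ_Ann[OF x])
  have "inv x \<odot> b = inv x \<otimes> b \<and> b \<odot> inv x = b \<otimes> inv x \<and> inv x \<otimes> b = b \<otimes> inv x"
    if b: "b \<in> carrier A" for b
  proof (intro conjI)
    have "x \<odot> (inv x \<otimes> b) = b" using b c by (simp add: Ann_circ[OF x])
    then have "inv x \<odot> b = inv x \<odot> (x \<odot> (inv x \<otimes> b))" by simp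
    also have "\<dots> = inv x \<otimes> b" using b c l by (simp flip: circ_assoc)
    finally show "inv x \<odot> b = inv x \<otimes> b" .
    have "(b \<otimes> inv x) \<odot> x = b" using b c by (simp add: circ_Ann[OF x] m_assoc)
    then have "b \<odot> inv x = ((b \<otimes> inv x) \<odot> x) \<odot> inv x" by simp
    also have "\<dots> = b \<otimes> inv x" using b c r by (simp add: circ_assoc)
    finally show "b \<odot> inv x = b \<otimes> inv x" .
    have "x \<otimes> (b \<otimes> inv x) = b" using Ann_commute[OF x, of "b \<otimes> inv x"] b c by (simp add: m_assoc)
    then show "inv x \<otimes> b = b \<otimes> inv x" using b c by (metis inv_solve_left m_closed)
  qed
  then show "inv x \<in> Ann A" using c by (simp add: Ann_iff)
next
  fix x y assume x: "x \<in> Ann A" and y: "y \<in> Ann A"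
  note c = Ann_closed[OF x] Ann_closed[OF y]
  have "x \<otimes> y \<odot> b = x \<otimes> y \<otimes> b \<and> b \<odot> (x \<otimes> y) = b \<otimes> (x \<otimes> y) \<and> x \<otimes> y \<otimes> b = b \<otimes> (x \<otimes> y)"
    if b: "b \<in> carrier A" for b
  proof (intro conjI)
    have "x \<otimes> y \<odot> b = x \<odot> (y \<odot> b)" using b c by (simp add: Ann_circ[OF x] flip: circ_assoc)
    also have "\<dots> = x \<otimes> y \<otimes> b"
      using b c by (simp add: circ_assoc m_assoc Ann_circ[OF x] Ann_circ[OF y])
    finally show "x \<otimes> y \<odot> b = x \<otimes> y \<otimes> b" .
    have "b \<odot> (x \<otimes> y) = b \<odot> x \<odot> y" using c b by (simp add: circ_assoc Ann_circ[OF x])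
    then show "b \<odot> (x \<otimes> y) = b \<otimes> (x \<otimes> y)"
      using b c by (simp add: m_assoc circ_Ann[OF x] circ_Ann[OF y])
    show "x \<otimes> y \<otimes> b = b \<otimes> (x \<otimes> y)"
      using b c Ann_commute[OF x b] Ann_commute[OF y b] by (metis m_assoc)
  qed
  then show "x \<otimes> y \<in> Ann A" using c by (simp add: Ann_iff)
qed (auto dest: Ann_closed)

lemma Ann_ideal: "brace_ideal (Ann A) A"
  by (rule central_subgroup_ideal[OF Ann_subgroup order_refl])

section \<open>The derived ideal\<close>

lemma Gamma2_subgroup: "subgroup (Gamma2 A) A"
  unfolding Gamma2_def by (rule generate_is_subgroup) auto

lemma star_in_Gamma2: "\<lbrakk>a \<in> carrier A; b \<in> carrier A\<rbrakk> \<Longrightarrow> brace_star A a b \<in> Gamma2 A"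
  unfolding Gamma2_def by (rule generate.incl) auto

lemma commutator_in_Gamma2:
  "\<lbrakk>a \<in> carrier A; b \<in> carrier A\<rbrakk> \<Longrightarrow> brace_commutator A a b \<in> Gamma2 A"
  unfolding Gamma2_def by (rule generate.incl) auto

text \<open>Conjugating \<open>x\<close> by \<open>a\<close> changes it by the factor \<open>[a, x]\<close>, which belongs to \<open>\<Gamma>\<^sub>2\<close>.\<close>

lemma Gamma2_normal: "Gamma2 A \<lhd> A"
proof (unfold normal_inv_iff, intro conjI ballI Gamma2_subgroup)
  interpret G: subgroup "Gamma2 A" A by (rule Gamma2_subgroup)
  fix a x assume a: "a \<in> carrier A" and x: "x \<in> Gamma2 A"
  have "a \<otimes> x \<otimes> inv a = brace_commutator A a x \<otimes> x"
    using a x by (simp add: brace_commutator_def m_assoc)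
  then show "a \<otimes> x \<otimes> inv a \<in> Gamma2 A" using a x commutator_in_Gamma2 by simp
qed

text \<open>The elements \<open>a \<odot> b\<close> and \<open>a \<otimes> b\<close> differ by a conjugate of the star of \<open>a\<close> and \<open>b\<close>, the elements
  \<open>a \<otimes> b\<close> and \<open>b \<otimes> a\<close> by their commutator.\<close>

lemma Gamma2_coset_mult:
  assumes "a \<in> carrier A" "b \<in> carrier A"
  shows "Gamma2 A #> (a \<odot> b) = Gamma2 A #> (a \<otimes> b)" "Gamma2 A #> (a \<otimes> b) = Gamma2 A #> (b \<otimes> a)"
proof -
  interpret G: normal "Gamma2 A" A by (rule Gamma2_normal)
  have absorb: "Gamma2 A #> (k \<otimes> x) = Gamma2 A #> x" if "k \<in> Gamma2 A" "x \<in> carrier A" for k x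
    using that G.rcos_const coset_mult_assoc[OF G.subset, of k x] by (simp add: G.is_subgroup)
  have k: "a \<otimes> brace_star A a b \<otimes> inv a \<in> Gamma2 A"
    using assms star_in_Gamma2 by (simp add: G.inv_op_closed2)
  have "a \<odot> b = (a \<otimes> brace_star A a b \<otimes> inv a) \<otimes> (a \<otimes> b)"
    using assms by (simp add: circ_eq_mult_star m_assoc)
  then show "Gamma2 A #> (a \<odot> b) = Gamma2 A #> (a \<otimes> b)" using absorb[OF k] assms by simp
  show "Gamma2 A #> (a \<otimes> b) = Gamma2 A #> (b \<otimes> a)"
    using absorb[OF commutator_in_Gamma2[OF assms]] mult_eq_commutator_mult[OF assms] assms
    by (metis m_closed)
qed

text \<open>Normality in the circle group is obtained without computing circle conjugates: by
  \<open>Gamma2_coset_mult\<close> the coset map for the multiplication is also a homomorphism on the circle group, and \<open>\<Gamma>\<^sub>2\<close> is its kernel there.\<close>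

lemma Gamma2_ideal: "brace_ideal (Gamma2 A) A"
proof -
  interpret G: normal "Gamma2 A" A by (rule Gamma2_normal)
  have "group_hom (circ_group A) (A Mod Gamma2 A) (\<lambda>a. Gamma2 A #> a)"
    by (intro group_hom.intro group_hom_axioms.intro circ_group_is_group G.factorgroup_is_group homI)
      (auto simp: FactGroup_def RCOSETS_def Gamma2_coset_mult G.rcos_sum)
  moreover have "kernel (circ_group A) (A Mod Gamma2 A) (\<lambda>a. Gamma2 A #> a) = Gamma2 A"
    using rcos_self[OF _ G.is_subgroup] G.rcos_const
    by (auto simp: kernel_def FactGroup_def G.is_subgroup)
  ultimately have "Gamma2 A \<lhd> circ_group A" using group_hom.normal_kernel by fastforce
  moreover have "brace_lambda A a x \<in> Gamma2 A" if "a \<in> carrier A" "x \<in> Gamma2 A" for a x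
  proof -
    have "brace_lambda A a x = brace_star A a x \<otimes> x"
      using that by (simp add: brace_star_def brace_lambda_def m_assoc)
    then show ?thesis using that star_in_Gamma2 by simp
  qed
  ultimately show ?thesis by (simp add: brace_ideal_def Gamma2_normal)
qed

lemma Ann_Gamma2_quotient:
  "Ann (brace_quotient A (Gamma2 A)) = carrier (brace_quotient A (Gamma2 A))"
proof -
  interpret q: skew_brace_hom A "brace_quotient A (Gamma2 A)" "\<lambda>a. Gamma2 A #> a"
    by (rule quotient_map_skew_brace_hom[OF Gamma2_ideal])
  have "x \<odot>\<^bsub>brace_quotient A (Gamma2 A)\<^esub> y = x \<otimes>\<^bsub>brace_quotient A (Gamma2 A)\<^esub> y \<and>
      x \<otimes>\<^bsub>brace_quotient A (Gamma2 A)\<^esub> y = y \<otimes>\<^bsub>brace_quotient A (Gamma2 A)\<^esub> x"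
    if xy: "x \<in> carrier (brace_quotient A (Gamma2 A))" "y \<in> carrier (brace_quotient A (Gamma2 A))" for x y
  proof -
    obtain a b where "a \<in> carrier A" "b \<in> carrier A" "x = Gamma2 A #> a" "y = Gamma2 A #> b"
      using xy quotient_map_surj[of "Gamma2 A"] by (metis (no_types, lifting) imageE)
    then show ?thesis
      using Gamma2_coset_mult q.mult q.circ by metis
  qed
  then show ?thesis by (auto simp: q.B.Ann_iff)
qed

end

section \<open>The common overbrace of two isoclinic skew braces\<close>

locale brace_isoclinism = A: skew_brace A + B: skew_brace B
  for A :: "('a, 'm) skew_brace_scheme" and B :: "('b, 'n) skew_brace_scheme" +
  fixes \<xi> \<theta>
  assumes xi: "\<xi> \<in> brace_iso (brace_quotient A (Ann A)) (brace_quotient B (Ann B))"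
    and theta: "\<theta> \<in> brace_iso (A\<lparr>carrier := Gamma2 A\<rparr>) (B\<lparr>carrier := Gamma2 B\<rparr>)"
    and compatible: "\<lbrakk>a\<^sub>1 \<in> carrier A; a\<^sub>2 \<in> carrier A; b\<^sub>1 \<in> carrier B; b\<^sub>2 \<in> carrier B;
        \<xi> (Ann A #>\<^bsub>A\<^esub> a\<^sub>1) = Ann B #>\<^bsub>B\<^esub> b\<^sub>1; \<xi> (Ann A #>\<^bsub>A\<^esub> a\<^sub>2) = Ann B #>\<^bsub>B\<^esub> b\<^sub>2\<rbrakk> \<Longrightarrow>
      \<theta> (brace_commutator A a\<^sub>1 a\<^sub>2) = brace_commutator B b\<^sub>1 b\<^sub>2 \<and>
      \<theta> (brace_star A a\<^sub>1 a\<^sub>2) = brace_star B b\<^sub>1 b\<^sub>2"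
begin

sublocale qA: skew_brace_hom A "brace_quotient A (Ann A)" "\<lambda>a. Ann A #>\<^bsub>A\<^esub> a"
  by (rule A.quotient_map_skew_brace_hom[OF A.Ann_ideal])

sublocale qB: skew_brace_hom B "brace_quotient B (Ann B)" "\<lambda>b. Ann B #>\<^bsub>B\<^esub> b"
  by (rule B.quotient_map_skew_brace_hom[OF B.Ann_ideal])

sublocale xi: skew_brace_hom "brace_quotient A (Ann A)" "brace_quotient B (Ann B)" \<xi>
  using xi qA.B.skew_brace_axioms qB.B.skew_brace_axioms
  by (intro skew_brace_homI) (simp_all add: brace_iso_def)

lemma xi_bij: "bij_betw \<xi> (carrier (brace_quotient A (Ann A))) (carrier (brace_quotient B (Ann B)))"
  using xi by (simp add: brace_iso_def)

sublocale theta: group_hom "A\<lparr>carrier := Gamma2 A\<rparr>" "B\<lparr>carrier := Gamma2 B\<rparr>" \<theta>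
  using theta A.Gamma2_subgroup B.Gamma2_subgroup
  by (intro group_hom.intro group_hom_axioms.intro)
    (simp_all add: brace_iso_def brace_hom_def subgroup.subgroup_is_group)

lemma theta_inj: "inj_on \<theta> (Gamma2 A)"
  using theta by (simp add: brace_iso_def bij_betw_def)

text \<open>The objects of the construction in order: the pullback \<open>C\<close> of \<open>A\<close> and \<open>B\<close> over
  their identified central quotients; \<open>T = C/\<Gamma>\<^sub>2(C)\<close>; the product \<open>A \<times> T\<close>; the embedding \<open>j\<close> of \<open>C\<close>
  into it; and the overbrace, in which the image under \<open>j\<close> of the kernel of \<open>C \<rightarrow> B\<close> is made trivial
  so that the image of \<open>C\<close> becomes a copy of \<open>B\<close>.\<close>

definition pullback_set :: "('a \<times> 'b) set" where
  "pullback_set = {c \<in> carrier (brace_prod A B). \<xi> (Ann A #>\<^bsub>A\<^esub> fst c) = Ann B #>\<^bsub>B\<^esub> snd c}"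

definition pullback :: "('a \<times> 'b) skew_brace" where
  "pullback = (brace_prod A B)\<lparr>carrier := pullback_set\<rparr>"

definition abelianization :: "('a \<times> 'b) set skew_brace" where
  "abelianization = brace_quotient pullback (Gamma2 pullback)"

definition ambient :: "('a \<times> ('a \<times> 'b) set) skew_brace" where
  "ambient = brace_prod A abelianization"

definition pullback_embedding :: "'a \<times> 'b \<Rightarrow> 'a \<times> ('a \<times> 'b) set" where
  "pullback_embedding c = (fst c, Gamma2 pullback #>\<^bsub>pullback\<^esub> c)"

definition amalgam_kernel :: "('a \<times> ('a \<times> 'b) set) set" where
  "amalgam_kernel = pullback_embedding ` kernel pullback B snd"

definition overbrace :: "('a \<times> ('a \<times> 'b) set) set skew_brace" where
  "overbrace = brace_quotient ambient amalgam_kernel"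

sublocale AB: skew_brace "brace_prod A B"
  by (intro skew_brace_prod A.skew_brace_axioms B.skew_brace_axioms)

lemma mem_pullback_iff: "c \<in> carrier pullback \<longleftrightarrow> fst c \<in> carrier A \<and> snd c \<in> carrier B \<and>
    \<xi> (Ann A #>\<^bsub>A\<^esub> fst c) = Ann B #>\<^bsub>B\<^esub> snd c"
  by (simp add: pullback_def pullback_set_def mem_Times_iff)

lemma pullback_one: "\<one>\<^bsub>pullback\<^esub> = (\<one>\<^bsub>A\<^esub>, \<one>\<^bsub>B\<^esub>)"
  by (simp add: pullback_def)

sublocale C: skew_brace pullback
  unfolding pullback_def
proof (rule AB.sub_skew_brace_imp_skew_brace)
  show "sub_skew_brace pullback_set (brace_prod A B)"
    unfolding pullback_set_def
  proof (rule sub_skew_brace_equalizer; rule skew_brace_homI)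
    show "(\<lambda>c. \<xi> (Ann A #>\<^bsub>A\<^esub> fst c)) \<in> brace_hom (brace_prod A B) (brace_quotient B (Ann B))"
      by (intro brace_hom_compose[OF _ xi.hom] brace_hom_compose[OF fst_brace_hom qA.hom])
    show "(\<lambda>c. Ann B #>\<^bsub>B\<^esub> snd c) \<in> brace_hom (brace_prod A B) (brace_quotient B (Ann B))"
      by (intro brace_hom_compose[OF snd_brace_hom qB.hom])
  qed (rule AB.skew_brace_axioms qB.B.skew_brace_axioms)+
qed

sublocale fst: skew_brace_hom pullback A fst
  using C.skew_brace_axioms A.skew_brace_axioms
  by (rule skew_brace_homI)
    (unfold pullback_def, rule brace_hom_restrict[OF fst_brace_hom], auto simp: pullback_set_def)

sublocale snd: skew_brace_hom pullback B snd
  using C.skew_brace_axioms B.skew_brace_axioms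
  by (rule skew_brace_homI)
    (unfold pullback_def, rule brace_hom_restrict[OF snd_brace_hom], auto simp: pullback_set_def)

lemma fst_surj: "fst ` carrier pullback = carrier A"
proof (intro equalityI subsetI)
  fix a assume a: "a \<in> carrier A"
  then have "\<xi> (Ann A #>\<^bsub>A\<^esub> a) \<in> (\<lambda>b. Ann B #>\<^bsub>B\<^esub> b) ` carrier B"
    unfolding B.quotient_map_surj by simp
  then obtain b where "(a, b) \<in> carrier pullback" using a by (auto simp: mem_pullback_iff)
  then show "a \<in> fst ` carrier pullback" by force
qed (use fst.closed in blast)

lemma snd_surj: "snd ` carrier pullback = carrier B"
proof (intro equalityI subsetI)
  fix b assume b: "b \<in> carrier B"
  then have "Ann B #>\<^bsub>B\<^esub> b \<in> \<xi> ` (\<lambda>a. Ann A #>\<^bsub>A\<^esub> a) ` carrier A"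
    unfolding A.quotient_map_surj bij_betw_imp_surj_on[OF xi_bij] by simp
  then obtain a where "(a, b) \<in> carrier pullback" using b by (auto simp: mem_pullback_iff)
  then show "b \<in> snd ` carrier pullback" by force
qed (use snd.closed in blast)

text \<open>If \<open>(a, 1) \<in> C\<close> then \<open>\<xi>\<close> sends the class of \<open>a\<close> to the trivial one, and \<open>\<xi>\<close> is injective.\<close>

lemma kernel_snd_fst_Ann:
  assumes "c \<in> kernel pullback B snd"
  shows "fst c \<in> Ann A"
proof -
  have c: "c \<in> carrier pullback" "snd c = \<one>\<^bsub>B\<^esub>" using assms by (auto simp: kernel_def)
  have "\<xi> (Ann A #>\<^bsub>A\<^esub> fst c) = Ann B #>\<^bsub>B\<^esub> snd c"
    using c(1) unfolding mem_pullback_iff by blast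
  also have "\<dots> = \<one>\<^bsub>brace_quotient B (Ann B)\<^esub>"
    unfolding c(2) by (rule qB.hom_one)
  finally have "\<xi> (Ann A #>\<^bsub>A\<^esub> fst c) = \<one>\<^bsub>brace_quotient B (Ann B)\<^esub>" .
  then have "\<xi> (Ann A #>\<^bsub>A\<^esub> fst c) = \<xi> \<one>\<^bsub>brace_quotient A (Ann A)\<^esub>" by simp
  then have "Ann A #>\<^bsub>A\<^esub> fst c = \<one>\<^bsub>brace_quotient A (Ann A)\<^esub>"
    using inj_onD[OF bij_betw_imp_inj_on[OF xi_bij]] c(1) by simp
  then show ?thesis
    using A.quotient_map_kernel[OF A.Ann_ideal] c(1) by (auto simp: kernel_def)
qed

text \<open>The place where the compatibility of \<open>\<xi>\<close> and \<open>\<theta>\<close> enters. The part of \<open>C\<close> on the graph of \<open>\<theta>\<close> is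
  a subgroup, and it contains the generators of \<open>\<Gamma>\<^sub>2(C)\<close> because stars and commutators in \<open>C\<close> are
  computed coordinatewise.\<close>

lemma Gamma2_pullback_graph:
  assumes "c \<in> Gamma2 pullback"
  shows "fst c \<in> Gamma2 A" "snd c = \<theta> (fst c)"
proof -
  interpret GA: subgroup "Gamma2 A" A by (rule A.Gamma2_subgroup)
  let ?G = "{c \<in> carrier pullback. fst c \<in> Gamma2 A \<and> snd c = \<theta> (fst c)}"
  have "subgroup ?G pullback"
  proof (rule C.subgroupI)
    have "\<one>\<^bsub>pullback\<^esub> \<in> ?G"
      using C.one_closed fst.hom_one snd.hom_one theta.hom_one by simp
    then show "?G \<noteq> {}" by blast
  next
    fix c assume c: "c \<in> ?G"
    then have "\<theta> (inv\<^bsub>A\<^esub> fst c) = inv\<^bsub>B\<^esub> (\<theta> (fst c))"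
      using theta.hom_inv[of "fst c"] theta.hom_closed[of "fst c"]
      by (simp add: A.m_inv_consistent[OF A.Gamma2_subgroup] B.m_inv_consistent[OF B.Gamma2_subgroup])
    then show "inv\<^bsub>pullback\<^esub> c \<in> ?G" using c by simp
  next
    fix c d assume "c \<in> ?G" "d \<in> ?G"
    then show "c \<otimes>\<^bsub>pullback\<^esub> d \<in> ?G" using theta.hom_mult[of "fst c" "fst d"] by simp
  qed auto
  moreover have "brace_star pullback c d \<in> ?G \<and> brace_commutator pullback c d \<in> ?G"
    if "c \<in> carrier pullback" "d \<in> carrier pullback" for c d
  proof -
    have "\<theta> (brace_commutator A (fst c) (fst d)) = brace_commutator B (snd c) (snd d) \<and>
        \<theta> (brace_star A (fst c) (fst d)) = brace_star B (snd c) (snd d)"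
      using that unfolding mem_pullback_iff by (intro compatible) blast+
    then show ?thesis
      using that by (simp add: fst.star snd.star fst.commutator snd.commutator
          A.star_in_Gamma2 A.commutator_in_Gamma2)
  qed
  ultimately have "Gamma2 pullback \<subseteq> ?G"
    unfolding Gamma2_def[of pullback] by (intro C.generate_subgroup_incl) auto
  then show "fst c \<in> Gamma2 A" "snd c = \<theta> (fst c)" using assms by auto
qed

sublocale T: skew_brace_hom pullback abelianization "\<lambda>c. Gamma2 pullback #>\<^bsub>pullback\<^esub> c"
  unfolding abelianization_def by (rule C.quotient_map_skew_brace_hom[OF C.Gamma2_ideal])

lemma Gamma2_coset_eq_one_iff:
  "c \<in> carrier pullback \<Longrightarrow>
     Gamma2 pullback #>\<^bsub>pullback\<^esub> c = \<one>\<^bsub>abelianization\<^esub> \<longleftrightarrow> c \<in> Gamma2 pullback"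
  using C.quotient_map_kernel[OF C.Gamma2_ideal] by (auto simp: kernel_def abelianization_def)

lemma Ann_abelianization: "Ann abelianization = carrier abelianization"
  unfolding abelianization_def by (rule C.Ann_Gamma2_quotient)

sublocale P: skew_brace ambient
  unfolding ambient_def by (intro skew_brace_prod A.skew_brace_axioms T.B.skew_brace_axioms)

sublocale j: skew_brace_hom pullback ambient pullback_embedding
  using C.skew_brace_axioms P.skew_brace_axioms
  by (rule skew_brace_homI) (rule brace_homI; simp add: ambient_def pullback_embedding_def)

text \<open>An element of the kernel has first coordinate \<open>1\<close> and lies on the graph of \<open>\<theta>\<close>, so its second
  coordinate is \<open>\<theta> 1 = 1\<close>.\<close>

lemma pullback_embedding_inj: "inj_on pullback_embedding (carrier pullback)"
proof (rule j.inj_on_one_iff[THEN iffD2, rule_format])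
  fix c assume c: "c \<in> carrier pullback" "pullback_embedding c = \<one>\<^bsub>ambient\<^esub>"
  then have "fst c = \<one>\<^bsub>A\<^esub>" "c \<in> Gamma2 pullback"
    using Gamma2_coset_eq_one_iff by (auto simp: pullback_embedding_def ambient_def)
  then show "c = \<one>\<^bsub>pullback\<^esub>"
    using Gamma2_pullback_graph(2) theta.hom_one by (simp add: pullback_one prod_eq_iff)
qed

lemma amalgam_kernel_ideal: "brace_ideal amalgam_kernel ambient"
proof (rule P.central_subgroup_ideal)
  show "subgroup amalgam_kernel ambient"
    unfolding amalgam_kernel_def by (intro j.subgroup_img_is_subgroup snd.subgroup_kernel)
  show "amalgam_kernel \<subseteq> Ann ambient"
  proof
    fix x assume "x \<in> amalgam_kernel"
    then obtain c where c: "c \<in> kernel pullback B snd" "x = pullback_embedding c"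
      by (auto simp: amalgam_kernel_def)
    then have "c \<in> carrier pullback" by (simp add: kernel_def)
    then show "x \<in> Ann ambient"
      unfolding c(2) ambient_def pullback_embedding_def
      by (intro Ann_prod A.skew_brace_axioms T.B.skew_brace_axioms kernel_snd_fst_Ann c(1))
        (simp add: Ann_abelianization)
  qed
qed

sublocale W: skew_brace_hom ambient overbrace "\<lambda>x. amalgam_kernel #>\<^bsub>ambient\<^esub> x"
  unfolding overbrace_def by (rule P.quotient_map_skew_brace_hom[OF amalgam_kernel_ideal])

lemma overbrace_coset_eq_one_iff:
  "x \<in> carrier ambient \<Longrightarrow>
     amalgam_kernel #>\<^bsub>ambient\<^esub> x = \<one>\<^bsub>overbrace\<^esub> \<longleftrightarrow> x \<in> amalgam_kernel"
  using P.quotient_map_kernel[OF amalgam_kernel_ideal] by (auto simp: kernel_def overbrace_def)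

definition embed_A :: "'a \<Rightarrow> ('a \<times> ('a \<times> 'b) set) set" where
  "embed_A a = amalgam_kernel #>\<^bsub>ambient\<^esub> (a, \<one>\<^bsub>abelianization\<^esub>)"

definition map_pullback :: "'a \<times> 'b \<Rightarrow> ('a \<times> ('a \<times> 'b) set) set" where
  "map_pullback c = amalgam_kernel #>\<^bsub>ambient\<^esub> pullback_embedding c"

sublocale embed_A: skew_brace_hom A overbrace embed_A
  unfolding embed_A_def
  by (intro skew_brace_homI A.skew_brace_axioms W.B.skew_brace_axioms
      brace_hom_compose[OF _ W.hom] brace_homI) (auto simp: ambient_def)

sublocale map_pullback: skew_brace_hom pullback overbrace map_pullback
  unfolding map_pullback_def
  by (intro skew_brace_homI C.skew_brace_axioms W.B.skew_brace_axioms
      brace_hom_compose[OF _ W.hom] j.hom)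

text \<open>If the class of \<open>(a, 1)\<close> is trivial, then \<open>(a, 1)\<close> equals \<open>j c\<close> for some \<open>c = (z, 1)\<close> in \<open>C\<close>.
  Comparing coordinates gives \<open>a = z\<close> and \<open>c \<in> \<Gamma>\<^sub>2(C)\<close>, so \<open>\<theta> a = 1\<close> and \<open>a = 1\<close> as \<open>\<theta>\<close> is
  injective.\<close>

lemma kernel_embed_A: "kernel A overbrace embed_A = {\<one>\<^bsub>A\<^esub>}"
proof -
  have "a = \<one>\<^bsub>A\<^esub>" if "a \<in> carrier A" "embed_A a = \<one>\<^bsub>overbrace\<^esub>" for a
  proof -
    have "(a, \<one>\<^bsub>abelianization\<^esub>) \<in> amalgam_kernel"
      using that overbrace_coset_eq_one_iff[of "(a, \<one>\<^bsub>abelianization\<^esub>)"]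
      by (simp add: embed_A_def ambient_def)
    then obtain c where c: "c \<in> carrier pullback" "snd c = \<one>\<^bsub>B\<^esub>" "fst c = a"
        "Gamma2 pullback #>\<^bsub>pullback\<^esub> c = \<one>\<^bsub>abelianization\<^esub>"
      by (auto simp: amalgam_kernel_def pullback_embedding_def kernel_def)
    then have "c \<in> Gamma2 pullback" using Gamma2_coset_eq_one_iff by blast
    then have "a \<in> Gamma2 A" "\<theta> a = \<theta> \<one>\<^bsub>A\<^esub>"
      using Gamma2_pullback_graph[of c] c(2,3) theta.hom_one by simp_all
    then show ?thesis
      using inj_onD[OF theta_inj] subgroup.one_closed[OF A.Gamma2_subgroup] by blast
  qed
  then show ?thesis by (auto simp: kernel_def)
qed

text \<open>Since \<open>j\<close> is injective, \<open>j c\<close> lies in the image of the kernel of \<open>C \<rightarrow> B\<close> only if \<open>c\<close> lies in that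
  kernel.\<close>

lemma kernel_map_pullback: "kernel pullback overbrace map_pullback = kernel pullback B snd"
proof -
  have "map_pullback c = \<one>\<^bsub>overbrace\<^esub> \<longleftrightarrow> c \<in> kernel pullback B snd" if "c \<in> carrier pullback" for c
    using that overbrace_coset_eq_one_iff[of "pullback_embedding c"]
      inj_on_image_mem_iff[OF pullback_embedding_inj that, of "kernel pullback B snd"]
    by (auto simp: map_pullback_def amalgam_kernel_def kernel_def)
  then show ?thesis by (auto simp: kernel_def)
qed

text \<open>As \<open>Ann T = T\<close>, the classes of \<open>1 \<times> T\<close> are in the annihilator of \<open>W\<close>, and multiplying by them turns
  any second coordinate into any other. Hence it suffices that \<open>S\<close> realises every first coordinate.\<close>

lemma covers_overbrace:
  assumes S: "S \<subseteq> carrier overbrace"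
    and meets: "\<And>a. a \<in> carrier A \<Longrightarrow>
      \<exists>t \<in> carrier abelianization. amalgam_kernel #>\<^bsub>ambient\<^esub> (a, t) \<in> S"
  shows "S <#>\<^bsub>overbrace\<^esub> Ann overbrace = carrier overbrace"
    and "S <#>\<^bsub>circ_group overbrace\<^esub> Ann overbrace = carrier overbrace"
proof -
  show eq: "S <#>\<^bsub>overbrace\<^esub> Ann overbrace = carrier overbrace"
  proof (intro equalityI subsetI)
    fix w assume "w \<in> S <#>\<^bsub>overbrace\<^esub> Ann overbrace"
    then show "w \<in> carrier overbrace" using S by (auto simp: set_mult_def dest: W.B.Ann_closed)
  next
    have surj: "(\<lambda>x. amalgam_kernel #>\<^bsub>ambient\<^esub> x) ` carrier ambient = carrier overbrace"
      unfolding overbrace_def by (rule P.quotient_map_surj)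
    fix w assume "w \<in> carrier overbrace"
    then obtain a t where at: "a \<in> carrier A" "t \<in> carrier abelianization"
      and w: "w = amalgam_kernel #>\<^bsub>ambient\<^esub> (a, t)"
      unfolding surj[symmetric] by (auto simp: ambient_def)
    obtain t' where t': "t' \<in> carrier abelianization"
      and s: "amalgam_kernel #>\<^bsub>ambient\<^esub> (a, t') \<in> S"
      using meets[OF at(1)] by blast
    define z where "z = (\<one>\<^bsub>A\<^esub>, inv\<^bsub>abelianization\<^esub> t' \<otimes>\<^bsub>abelianization\<^esub> t)"
    have z: "z \<in> Ann ambient"
      using at(2) t' subgroup.one_closed[OF A.Ann_subgroup] unfolding z_def ambient_def
      by (intro Ann_prod) (simp_all add: A.skew_brace_axioms T.B.skew_brace_axioms Ann_abelianization)
    have "(a, t) = (a, t') \<otimes>\<^bsub>ambient\<^esub> z"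
      using at t' by (simp add: z_def ambient_def flip: T.B.m_assoc)
    then have "w = (amalgam_kernel #>\<^bsub>ambient\<^esub> (a, t')) \<otimes>\<^bsub>overbrace\<^esub> (amalgam_kernel #>\<^bsub>ambient\<^esub> z)"
      using w at t' P.Ann_closed[OF z] W.mult[of "(a, t')" z] by (simp add: ambient_def)
    then show "w \<in> S <#>\<^bsub>overbrace\<^esub> Ann overbrace"
      using s W.surj_maps_Ann[OF surj z] by (auto simp: set_mult_def)
  qed
  show "S <#>\<^bsub>circ_group overbrace\<^esub> Ann overbrace = carrier overbrace"
    using W.B.set_mult_Ann[OF S] eq by simp
qed

lemma A_isomorphic: "brace_isomorphic A (overbrace\<lparr>carrier := embed_A ` carrier A\<rparr>)"
proof (rule kernel_eq_imp_isomorphic_image[OF _ embed_A.skew_brace_hom_axioms])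
  show "skew_brace_hom A A (\<lambda>a. a)"
    by (intro skew_brace_homI A.skew_brace_axioms brace_homI) simp_all
  show "kernel A A (\<lambda>a. a) = kernel A overbrace embed_A"
    unfolding kernel_embed_A by (auto simp: kernel_def)
qed simp

lemma B_isomorphic: "brace_isomorphic B (overbrace\<lparr>carrier := map_pullback ` carrier pullback\<rparr>)"
  by (rule kernel_eq_imp_isomorphic_image[OF snd.skew_brace_hom_axioms
        map_pullback.skew_brace_hom_axioms snd_surj kernel_map_pullback[symmetric]])

lemma A_covers:
  "(embed_A ` carrier A) <#>\<^bsub>overbrace\<^esub> Ann overbrace = carrier overbrace"
  "(embed_A ` carrier A) <#>\<^bsub>circ_group overbrace\<^esub> Ann overbrace = carrier overbrace"
  by (rule covers_overbrace; force simp: embed_A_def[symmetric])+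

lemma B_covers:
  "(map_pullback ` carrier pullback) <#>\<^bsub>overbrace\<^esub> Ann overbrace = carrier overbrace"
  "(map_pullback ` carrier pullback) <#>\<^bsub>circ_group overbrace\<^esub> Ann overbrace = carrier overbrace"
proof -
  have sub: "map_pullback ` carrier pullback \<subseteq> carrier overbrace" by auto
  have meets: "\<exists>t \<in> carrier abelianization.
      amalgam_kernel #>\<^bsub>ambient\<^esub> (a, t) \<in> map_pullback ` carrier pullback"
    if "a \<in> carrier A" for a
  proof -
    have "a \<in> fst ` carrier pullback" using that fst_surj by simp
    then obtain c where c: "c \<in> carrier pullback" "fst c = a" by auto
    have "amalgam_kernel #>\<^bsub>ambient\<^esub> (a, Gamma2 pullback #>\<^bsub>pullback\<^esub> c) = map_pullback c"
      using c(2) by (simp add: map_pullback_def pullback_embedding_def)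
    then show ?thesis using c(1) T.closed[OF c(1)] by (metis imageI)
  qed
  show "(map_pullback ` carrier pullback) <#>\<^bsub>overbrace\<^esub> Ann overbrace = carrier overbrace"
    "(map_pullback ` carrier pullback) <#>\<^bsub>circ_group overbrace\<^esub> Ann overbrace = carrier overbrace"
    using covers_overbrace[OF sub meets] by simp_all
qed

end

theorem theoremC:
  fixes A :: "'a skew_brace" and B :: "'b skew_brace"
  assumes "skew_brace A" and "skew_brace B" and "isoclinic A B"
  shows "\<exists>(W :: ('a \<times> ('a \<times> 'b) set) set skew_brace) Abar Bbar.
    skew_brace W \<and> sub_skew_brace Abar W \<and> sub_skew_brace Bbar W \<and>
    brace_isomorphic A (W\<lparr>carrier := Abar\<rparr>) \<and> brace_isomorphic B (W\<lparr>carrier := Bbar\<rparr>) \<and>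
    Abar <#>\<^bsub>W\<^esub> Ann W = carrier W \<and> Abar <#>\<^bsub>circ_group W\<^esub> Ann W = carrier W \<and>
    Bbar <#>\<^bsub>circ_group W\<^esub> Ann W = carrier W \<and> Bbar <#>\<^bsub>W\<^esub> Ann W = carrier W"
proof -
  obtain \<xi> \<theta> where "brace_isoclinism A B \<xi> \<theta>"
    using assms unfolding isoclinic_def brace_isoclinism_def brace_isoclinism_axioms_def by blast
  then interpret brace_isoclinism A B \<xi> \<theta> .
  show ?thesis
    using W.B.skew_brace_axioms embed_A.image_sub_skew_brace map_pullback.image_sub_skew_brace
      A_isomorphic B_isomorphic A_covers B_covers
    by blast
qed

end
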